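(* Let $K\subset\mathbb R^D$ be a star-regular polytope centered on the origin and let the representation space $\mathcal V$ be the space of polynomials in $D$ variables of degree at most $1$. Assume that the origin is the only point whose orbit under the isometries of $K$ is a singleton. Then the optimal interior weight is $\overline M^\star=1$, and the positivity-preserving time step is guaranteed simply by enforcing positivity at the boundary nodes: if $U\in\mathcal V$ satisfies $U\ge0$ at the boundary nodes, $\overline h\le\overline\lambda\,U$ at each boundary node, and $\Delta t\ge 0$ satisfies $\overline\lambda\,\Delta t\le 1/\overline M^\star=1$, then the updated cell average $\overline{\mathcal C}U-\Delta t\,\overline{\mathcal B}\,\overline h$ is nonnegative.
   Context: A star-regular polytope is a star-convex polytope that can be centered on the origin so that $\hat{\mathbf n}\cdot\mathbf x$ is constant on its boundary ($\hat{\mathbf n}$ the outward unit normal). The isometries of $K$ are the isometries of $\mathbb R^D$ mapping $K$ onto itself. $\overline{\mathcal C}(U)$ is the average of $U$ over $K$; $\overline{\mathcal B}(U)$ is the average of $U$ over $\partial K$, computed by a quadrature $\overline{\mathcal B}g=\sum_{\mathbf x\in Q}b_{\mathbf x}g(\mathbf x)$ with finitely many boundary nodes $Q\subset\partial K$ and weights $b_{\mathbf x}>0$, exact for $U\in\mathcal V$. $\overline M^\star:=\sup\{\overline{\mathcal B}(U)/\overline{\mathcal C}(U): U\in\mathcal V,\ U\ge0\text{ in }K,\ \overline{\mathcal C}(U)>0\}$. The scaled numerical flux $\overline h$ is a real-valued function on the boundary nodes (outward flux times boundary area over cell volume), $\overline\lambda$ is a real number (scaled speed cap), and an Euler step replaces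 $\overline{\mathcal C}U$ by $\overline{\mathcal C}U-\Delta t\,\overline{\mathcal B}\,\overline h$. *)

theory Defs
  imports "HOL-Analysis.Analysis"
begin

section \<open>Surface measure\<close>

text \<open>
  \<open>hausdorff_gauge s \<delta> C\<close> is \<open>\<omega>\<^sub>s (diam C / 2)\<^sup>s\<close> for sets of diameter at most \<open>\<delta>\<close>, with \<open>\<omega>\<^sub>s\<close> the
  volume of the unit ball of dimension \<open>s\<close>; larger sets cost \<open>\<infinity>\<close>, so they never help in a
  cover. For \<open>s = 0\<close> nonempty sets cost 1 (\<open>0 ^ 0 = 1\<close>) and the empty set costs 0, which gives
  counting measure.
\<close>

definition hausdorff_gauge :: "nat \<Rightarrow> real \<Rightarrow> 'a::metric_space set \<Rightarrow> ennreal" where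
  "hausdorff_gauge s \<delta> C =
     (if C = {} then 0
      else if bounded C \<and> diameter C \<le> \<delta>
        then ennreal (unit_ball_vol (real s) * (diameter C / 2) ^ s)
      else \<infinity>)"

text \<open>
  The library's \<^const>\<open>outer_measure\<close> takes the infimum over countable disjoint covers. As the gauge
  is monotone, this is the infimum over all countable covers.
\<close>

definition hausdorff_outer :: "nat \<Rightarrow> 'a::metric_space set \<Rightarrow> ennreal" where
  "hausdorff_outer s A = (SUP \<delta>\<in>{0<..}. outer_measure UNIV (hausdorff_gauge s \<delta>) A)"

definition hausdorff_measure :: "nat \<Rightarrow> 'a::metric_space measure" where
  "hausdorff_measure s = measure_of UNIV (sets borel) (hausdorff_outer s)"

lemma sets_hausdorff_measure [measurable_cong, simp]: "sets (hausdorff_measure s) = sets borel"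
  by (simp add: hausdorff_measure_def sets.sigma_sets_eq[of borel, simplified])

lemma space_hausdorff_measure [simp]: "space (hausdorff_measure s) = UNIV"
  by (simp add: hausdorff_measure_def)

text \<open>
  \<^const>\<open>measure_of\<close> yields the zero measure unless the given set function is countably additive.
  The rest of this section (Caratheodory's criterion for metric outer measures) shows that it is.
\<close>

lemma positive_hausdorff_gauge: "positive UNIV (hausdorff_gauge s \<delta>)"
  by (simp add: positive_def hausdorff_gauge_def)

lemma increasing_hausdorff_gauge: "increasing UNIV (hausdorff_gauge s \<delta>)"
  unfolding increasing_def
proof (intro ballI impI)
  fix A B :: "'a set" assume "A \<subseteq> B"
  show "hausdorff_gauge s \<delta> A \<le> hausdorff_gauge s \<delta> B"
  proof (cases "A = {} \<or> \<not> (bounded B \<and> diameter B \<le> \<delta>)")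
    case True
    then show ?thesis using \<open>A \<subseteq> B\<close> by (auto simp: hausdorff_gauge_def)
  next
    case False
    then have B: "A \<noteq> {}" "B \<noteq> {}" "bounded B" "diameter B \<le> \<delta>"
      using \<open>A \<subseteq> B\<close> by auto
    have A: "bounded A" "diameter A \<le> diameter B"
      using bounded_subset[OF B(3) \<open>A \<subseteq> B\<close>] diameter_subset[OF \<open>A \<subseteq> B\<close> B(3)] by auto
    have "unit_ball_vol (real s) * (diameter A / 2) ^ s
        \<le> unit_ball_vol (real s) * (diameter B / 2) ^ s"
      using A diameter_ge_0[OF A(1)]
      by (intro mult_left_mono power_mono) (auto intro: less_imp_le)
    then show ?thesis using A B by (auto simp: hausdorff_gauge_def intro: ennreal_leI)
  qed
qed

lemma outer_measure_space_hausdorff_gauge: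
  "outer_measure_space UNIV (outer_measure UNIV (hausdorff_gauge s \<delta>))"
  using ring_of_sets.outer_measure_space_outer_measure[OF ring_of_sets_Pow,
      of UNIV "hausdorff_gauge s \<delta>"]
  by (simp add: positive_hausdorff_gauge increasing_hausdorff_gauge)

lemma outer_measure_space_hausdorff_outer: "outer_measure_space UNIV (hausdorff_outer s)"
  unfolding outer_measure_space_def
proof (intro conjI)
  let ?H = "\<lambda>\<delta>. outer_measure UNIV (hausdorff_gauge s \<delta>) :: 'a set \<Rightarrow> ennreal"
  have H: "positive UNIV (?H \<delta>)" "increasing UNIV (?H \<delta>)" "countably_subadditive UNIV (?H \<delta>)" for \<delta>
    using outer_measure_space_hausdorff_gauge[of s \<delta>, where 'a = 'a]
    by (simp_all add: outer_measure_space_def)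
  show "positive UNIV (hausdorff_outer s :: 'a set \<Rightarrow> ennreal)"
    using H(1) by (simp add: positive_def hausdorff_outer_def)
  show "increasing UNIV (hausdorff_outer s :: 'a set \<Rightarrow> ennreal)"
    using H(2) by (auto simp: increasing_def hausdorff_outer_def intro!: SUP_mono')
  show "countably_subadditive UNIV (hausdorff_outer s :: 'a set \<Rightarrow> ennreal)"
    unfolding countably_subadditive_def hausdorff_outer_def
  proof (intro allI impI SUP_least)
    fix A :: "nat \<Rightarrow> 'a set" and \<delta> :: real
    assume A: "range A \<subseteq> UNIV" "disjoint_family A" "(\<Union>i. A i) \<in> UNIV" and \<delta>: "\<delta> \<in> {0<..}"
    have "?H \<delta> (\<Union>i. A i) \<le> (\<Sum>i. ?H \<delta> (A i))"
      using H(3) A unfolding countably_subadditive_def by blast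
    also have "\<dots> \<le> (\<Sum>i. SUP \<delta>\<in>{0<..}. ?H \<delta> (A i))"
      using \<delta> by (intro suminf_le SUP_upper) auto
    finally show "?H \<delta> (\<Union>i. A i) \<le> \<dots>" .
  qed
qed

lemma hausdorff_outer_empty [simp]: "hausdorff_outer s ({} :: 'a::metric_space set) = 0"
  using outer_measure_space_hausdorff_outer[of s, where 'a = 'a]
  by (simp add: outer_measure_space_def positive_def)

lemma hausdorff_outer_mono:
  fixes A B :: "'a::metric_space set"
  shows "A \<subseteq> B \<Longrightarrow> hausdorff_outer s A \<le> hausdorff_outer s B"
  using outer_measure_space_hausdorff_outer[of s, where 'a = 'a]
  by (simp add: outer_measure_space_def increasing_def)

lemma hausdorff_outer_Un:
  fixes A B :: "'a::metric_space set"
  shows "hausdorff_outer s (A \<union> B) \<le> hausdorff_outer s A + hausdorff_outer s B"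
proof -
  have "hausdorff_outer s (A \<union> (B - A)) \<le> hausdorff_outer s A + hausdorff_outer s (B - A)"
    using outer_measure_space_hausdorff_outer[of s, where 'a = 'a]
      ring_of_sets.countably_subadditive_subadditive[OF ring_of_sets_Pow,
        of "UNIV :: 'a set" "hausdorff_outer s"]
    by (intro subadditiveD[of UNIV "hausdorff_outer s"]) (auto simp: outer_measure_space_def)
  also have "\<dots> \<le> hausdorff_outer s A + hausdorff_outer s B"
    by (intro add_left_mono hausdorff_outer_mono) auto
  finally show ?thesis by simp
qed

lemma hausdorff_outer_UN:
  fixes A :: "nat \<Rightarrow> 'a::metric_space set"
  shows "hausdorff_outer s (\<Union>i::nat. A i) \<le> (\<Sum>i. hausdorff_outer s (A i))"
proof -
  have "hausdorff_outer s (\<Union>i. disjointed A i) \<le> (\<Sum>i. hausdorff_outer s (disjointed A i))"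
    using outer_measure_space_hausdorff_outer[of s, where 'a = 'a] disjoint_family_disjointed[of A]
    by (auto simp: outer_measure_space_def countably_subadditive_def)
  also have "\<dots> \<le> (\<Sum>i. hausdorff_outer s (A i))"
    by (intro suminf_le hausdorff_outer_mono disjointed_subset) auto
  finally show ?thesis by (simp add: UN_disjointed_eq)
qed

lemma outer_measure_hausdorff_gauge_eq_INF:
  "outer_measure UNIV (hausdorff_gauge s \<delta>) A
     = (INF C\<in>{C :: nat \<Rightarrow> 'a::metric_space set. A \<subseteq> (\<Union>i. C i)}. \<Sum>i. hausdorff_gauge s \<delta> (C i))"
proof (rule antisym)
  show "outer_measure UNIV (hausdorff_gauge s \<delta>) A
      \<le> (INF C\<in>{C :: nat \<Rightarrow> 'a::metric_space set. A \<subseteq> (\<Union>i. C i)}. \<Sum>i. hausdorff_gauge s \<delta> (C i))"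
    using ring_of_sets.outer_measure_le[OF ring_of_sets_Pow, of UNIV "hausdorff_gauge s \<delta>"]
    by (intro INF_greatest)
       (auto simp: positive_hausdorff_gauge increasing_hausdorff_gauge)
qed (auto simp: outer_measure_def intro!: INF_superset_mono)

lemma hausdorff_outer_separated:
  fixes A B :: "'a::metric_space set"
  assumes "0 < e" and sep: "\<And>x y. x \<in> A \<Longrightarrow> y \<in> B \<Longrightarrow> e \<le> dist x y"
  shows "hausdorff_outer s A + hausdorff_outer s (B :: 'a set) \<le> hausdorff_outer s (A \<union> B)"
proof -
  let ?H = "\<lambda>\<delta>. outer_measure UNIV (hausdorff_gauge s \<delta>) :: 'a set \<Rightarrow> ennreal"
  have H_anti: "?H \<delta>' X \<le> ?H \<delta> X" if "\<delta> \<le> \<delta>'" for \<delta> \<delta>' X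
    unfolding outer_measure_hausdorff_gauge_eq_INF
    using that by (intro INF_mono' suminf_le) (auto simp: hausdorff_gauge_def)
  have small: "?H \<delta> A + ?H \<delta> B \<le> ?H \<delta> (A \<union> B)" if \<delta>: "0 < \<delta>" "\<delta> < e" for \<delta>
  proof -
    have "?H \<delta> A + ?H \<delta> B \<le> (\<Sum>i. hausdorff_gauge s \<delta> (C i))"
      if C: "A \<union> B \<subseteq> (\<Union>i. C i)" for C :: "nat \<Rightarrow> 'a set"
    proof -
      have 1: "?H \<delta> A \<le> (\<Sum>i. hausdorff_gauge s \<delta> (C i \<inter> A))"
        unfolding outer_measure_hausdorff_gauge_eq_INF using C by (intro INF_lower) auto
      have 2: "?H \<delta> B \<le> (\<Sum>i. hausdorff_gauge s \<delta> (C i \<inter> B))"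
        unfolding outer_measure_hausdorff_gauge_eq_INF using C by (intro INF_lower) auto
      have 3: "hausdorff_gauge s \<delta> (C i \<inter> A) + hausdorff_gauge s \<delta> (C i \<inter> B)
          \<le> hausdorff_gauge s \<delta> (C i)" for i
      proof (cases "bounded (C i) \<and> diameter (C i) \<le> \<delta>")
        case True
        have "C i \<inter> A = {} \<or> C i \<inter> B = {}"
        proof (rule ccontr)
          assume "\<not> ?thesis"
          then obtain x y where xy: "x \<in> C i" "x \<in> A" "y \<in> C i" "y \<in> B" by auto
          then show False
            using diameter_bounded_bound[of "C i" x y] True sep[of x y] \<delta> by auto
        qed
        moreover have "hausdorff_gauge s \<delta> (C i \<inter> X) \<le> hausdorff_gauge s \<delta> (C i)" for X
          by (rule increasingD[OF increasing_hausdorff_gauge]) auto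
        ultimately show ?thesis by (auto simp: hausdorff_gauge_def[of _ _ "{}"])
      qed (auto simp: hausdorff_gauge_def)
      have "?H \<delta> A + ?H \<delta> B
          \<le> (\<Sum>i. hausdorff_gauge s \<delta> (C i \<inter> A) + hausdorff_gauge s \<delta> (C i \<inter> B))"
        using add_mono[OF 1 2] by (simp add: suminf_add)
      also have "\<dots> \<le> (\<Sum>i. hausdorff_gauge s \<delta> (C i))"
        using 3 by (intro suminf_le) auto
      finally show ?thesis .
    qed
    then show ?thesis
      unfolding outer_measure_hausdorff_gauge_eq_INF[of _ _ "A \<union> B"] by (intro INF_greatest) auto
  qed
  have "?H \<delta> A + ?H \<delta>' B \<le> hausdorff_outer s (A \<union> B)" if "0 < \<delta>" "0 < \<delta>'" for \<delta> \<delta>'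
  proof -
    define \<eta> where "\<eta> = Min {\<delta>, \<delta>', e / 2}"
    have \<eta>: "0 < \<eta>" "\<eta> < e" "\<eta> \<le> \<delta>" "\<eta> \<le> \<delta>'" using that \<open>0 < e\<close> by (auto simp: \<eta>_def)
    have "?H \<delta> A + ?H \<delta>' B \<le> ?H \<eta> A + ?H \<eta> B" using \<eta> by (intro add_mono H_anti)
    also have "\<dots> \<le> ?H \<eta> (A \<union> B)" using \<eta> by (intro small)
    also have "\<dots> \<le> hausdorff_outer s (A \<union> B)"
      unfolding hausdorff_outer_def using \<eta> by (intro SUP_upper) auto
    finally show ?thesis .
  qed
  note bound = this
  have "?H \<delta> A + hausdorff_outer s B \<le> hausdorff_outer s (A \<union> B)" if "0 < \<delta>" for \<delta>
  proof -
    have "?H \<delta> A + hausdorff_outer s B = (SUP \<delta>'\<in>{0<..}. ?H \<delta> A + ?H \<delta>' B)"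
      unfolding hausdorff_outer_def[of s B] by (rule ennreal_SUP_add_right) simp
    also have "\<dots> \<le> hausdorff_outer s (A \<union> B)"
      using bound that by (intro SUP_least) auto
    finally show ?thesis .
  qed
  note bound' = this
  have "hausdorff_outer s A + hausdorff_outer s B
      = (SUP \<delta>\<in>{0<..}. ?H \<delta> A + hausdorff_outer s B)"
    unfolding hausdorff_outer_def[of s A] by (rule ennreal_SUP_add_left[symmetric]) simp
  also have "\<dots> \<le> hausdorff_outer s (A \<union> B)"
    using bound' by (intro SUP_least) auto
  finally show ?thesis .
qed

lemma hausdorff_outer_separated_UN:
  fixes R :: "nat \<Rightarrow> 'a::metric_space set"
  assumes "\<And>i j. i < j \<Longrightarrow> \<exists>e>0. \<forall>x\<in>R i. \<forall>y\<in>R j. e \<le> dist x y"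
  shows "(\<Sum>i<n. hausdorff_outer s (R i)) \<le> hausdorff_outer s (\<Union>i<n. R i)"
proof (induction n)
  case (Suc n)
  have "\<forall>i\<in>{..<n}. \<exists>e>0. \<forall>x\<in>R i. \<forall>y\<in>R n. e \<le> dist x y" using assms by auto
  then obtain e where e: "\<And>i. i < n \<Longrightarrow> 0 < e i"
      "\<And>i x y. i < n \<Longrightarrow> x \<in> R i \<Longrightarrow> y \<in> R n \<Longrightarrow> e i \<le> dist x y"
    by (metis lessThan_iff)
  define m where "m = Min (insert 1 (e ` {..<n}))"
  have m: "0 < m" "\<And>i. i < n \<Longrightarrow> m \<le> e i" using e(1) by (auto simp: m_def)
  have step: "hausdorff_outer s (\<Union>i<n. R i) + hausdorff_outer s (R n)
      \<le> hausdorff_outer s ((\<Union>i<n. R i) \<union> R n)"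
    using m e(2) by (intro hausdorff_outer_separated[of m]) (auto, meson order_trans)
  have "(\<Sum>i<Suc n. hausdorff_outer s (R i))
      \<le> hausdorff_outer s (\<Union>i<n. R i) + hausdorff_outer s (R n)"
    unfolding sum.lessThan_Suc by (intro add_right_mono Suc.IH)
  also have "\<dots> \<le> hausdorff_outer s ((\<Union>i<n. R i) \<union> R n)" by (rule step)
  finally show ?case by (simp add: lessThan_Suc Un_commute)
qed simp

lemma closed_in_lambda_system_hausdorff_outer:
  fixes F :: "'a::metric_space set"
  assumes "closed F"
  shows "F \<in> lambda_system UNIV UNIV (hausdorff_outer s)"
proof (cases "F = {}")
  case True
  then show ?thesis by (auto simp: lambda_system_def)
next
  case False
  let ?\<mu> = "hausdorff_outer s :: 'a set \<Rightarrow> ennreal"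
  have key: "?\<mu> (A \<inter> F) + ?\<mu> (A - F) \<le> ?\<mu> A" for A
  proof (cases "?\<mu> A = \<infinity>")
    case False
    define B where "B n = {x \<in> A. 1 / real (Suc n) \<le> infdist x F}" for n
    define R where "R n = B (Suc n) - B n" for n
    have Rub: "infdist x F < 1 / real (Suc n)" if "x \<in> R n" for x n
      using that by (auto simp: R_def B_def)
    have Rlb: "1 / real (Suc (Suc n)) \<le> infdist x F" if "x \<in> R n" for x n
      using that by (auto simp: R_def B_def)
    have R_sep: "\<exists>e>0. \<forall>x\<in>R i. \<forall>y\<in>R j. e \<le> dist x y" if ij: "Suc i < j" for i j
    proof (intro exI conjI ballI)
      show "0 < 1 / real (Suc (Suc i)) - 1 / real (Suc j)"
        using ij by (simp add: frac_less2)
      fix x y assume "x \<in> R i" "y \<in> R j"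
      then show "1 / real (Suc (Suc i)) - 1 / real (Suc j) \<le> dist x y"
        using Rlb[of x i] Rub[of y j] infdist_triangle[of x F y] by linarith
    qed
    have fin: "(\<Sum>i. ?\<mu> (R (2 * i + k))) \<le> ?\<mu> A" for k
    proof (rule suminf_le_const[OF summableI])
      fix n
      have "(\<Sum>i<n. ?\<mu> (R (2 * i + k))) \<le> ?\<mu> (\<Union>i<n. R (2 * i + k))"
        by (rule hausdorff_outer_separated_UN) (intro R_sep, auto)
      also have "\<dots> \<le> ?\<mu> A" by (intro hausdorff_outer_mono) (auto simp: R_def B_def)
      finally show "(\<Sum>i<n. ?\<mu> (R (2 * i + k))) \<le> ?\<mu> A" .
    qed
    have part: "(\<Sum>i<n. ?\<mu> (R i)) \<le> ?\<mu> A + ?\<mu> A" for n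
    proof -
      have "(\<Sum>i<n. ?\<mu> (R i)) \<le> (\<Sum>i<2 * n. ?\<mu> (R i))"
        by (intro sum_mono2) auto
      also have "\<dots> = (\<Sum>i<n. ?\<mu> (R (2 * i + 0))) + (\<Sum>i<n. ?\<mu> (R (2 * i + 1)))"
        by (induction n) (auto simp: algebra_simps)
      also have "\<dots> \<le> (\<Sum>i. ?\<mu> (R (2 * i + 0))) + (\<Sum>i. ?\<mu> (R (2 * i + 1)))"
        by (intro add_mono sum_le_suminf summableI) auto
      also have "\<dots> \<le> ?\<mu> A + ?\<mu> A" by (intro add_mono fin)
      finally show ?thesis .
    qed
    have "(\<Sum>i. ?\<mu> (R i)) \<le> ?\<mu> A + ?\<mu> A"
      by (rule suminf_le_const[OF summableI part])
    also have "\<dots> < \<infinity>" using False by (simp add: less_top)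
    finally have sum_fin: "(\<Sum>i. ?\<mu> (R i)) \<noteq> \<infinity>" by simp
    have sub: "A - F \<subseteq> B n \<union> (\<Union>i. R (i + n))" for n
    proof
      fix x assume x: "x \<in> A - F"
      then have "0 < infdist x F"
        using \<open>closed F\<close> \<open>F \<noteq> {}\<close> in_closed_iff_infdist_zero[of F x] infdist_nonneg[of x F]
        by (metis Diff_iff less_eq_real_def)
      then obtain m where "1 / real (Suc m) < infdist x F"
        using reals_Archimedean by (auto simp: inverse_eq_divide)
      then have ex: "x \<in> B m" using x by (auto simp: B_def)
      show "x \<in> B n \<union> (\<Union>i. R (i + n))"
      proof (cases "x \<in> B n")
        case False
        define k where "k = (LEAST k. x \<in> B (k + n))"
        have mono: "B a \<subseteq> B b" if "a \<le> b" for a b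
        proof -
          have "1 / real (Suc b) \<le> 1 / real (Suc a)" using that by (intro frac_le) auto
          then show ?thesis unfolding B_def by (auto intro: order_trans simp del: of_nat_Suc)
        qed
        have "x \<in> B (m + n)" using ex mono[of m "m + n"] by auto
        then have k: "x \<in> B (k + n)" unfolding k_def by (rule LeastI)
        with False obtain l where l: "k = Suc l" by (cases k) auto
        have "x \<notin> B (l + n)" using l not_less_Least[of l "\<lambda>k. x \<in> B (k + n)"] by (auto simp: k_def)
        with k l have "x \<in> R (l + n)" by (auto simp: R_def)
        then show ?thesis by auto
      qed auto
    qed
    have "?\<mu> (A \<inter> F) + ?\<mu> (A - F) \<le> ?\<mu> A + (\<Sum>i. ?\<mu> (R (i + n)))" for n
    proof -
      have "?\<mu> (A - F) \<le> ?\<mu> (B n) + ?\<mu> (\<Union>i. R (i + n))"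
        using hausdorff_outer_mono[OF sub] hausdorff_outer_Un order_trans by blast
      also have "\<dots> \<le> ?\<mu> (B n) + (\<Sum>i. ?\<mu> (R (i + n)))"
        by (intro add_left_mono hausdorff_outer_UN)
      finally have "?\<mu> (A \<inter> F) + ?\<mu> (A - F)
          \<le> (?\<mu> (A \<inter> F) + ?\<mu> (B n)) + (\<Sum>i. ?\<mu> (R (i + n)))"
        by (simp add: add.assoc add_left_mono)
      also have "?\<mu> (A \<inter> F) + ?\<mu> (B n) \<le> ?\<mu> ((A \<inter> F) \<union> B n)"
      proof (rule hausdorff_outer_separated)
        show "0 < 1 / real (Suc n)" by simp
        fix x y assume "x \<in> A \<inter> F" "y \<in> B n"
        then show "1 / real (Suc n) \<le> dist x y"
          using infdist_le[of x F y] by (auto simp: B_def dist_commute)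
      qed
      also have "\<dots> \<le> ?\<mu> A" by (intro hausdorff_outer_mono) (auto simp: B_def)
      finally show ?thesis by (simp add: add_right_mono)
    qed
    moreover have "(\<lambda>n. ?\<mu> A + (\<Sum>i. ?\<mu> (R (i + n)))) \<longlonglongrightarrow> ?\<mu> A + 0"
    proof (intro tendsto_add tendsto_const)
      let ?S = "\<Sum>i. ?\<mu> (R i)"
      have "?S = (\<Sum>i. ?\<mu> (R (i + n))) + (\<Sum>i<n. ?\<mu> (R i))" for n
        by (subst suminf_offset[OF summableI, of _ n]) (simp add: add.commute)
      moreover have "(\<Sum>i<n. ?\<mu> (R i)) \<noteq> \<infinity>" for n
      proof -
        have "(\<Sum>i<n. ?\<mu> (R i)) \<le> ?S" by (intro sum_le_suminf summableI) auto
        then show ?thesis using sum_fin neq_top_trans by auto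
      qed
      ultimately have "(\<Sum>i. ?\<mu> (R (i + n))) = ?S - (\<Sum>i<n. ?\<mu> (R i))" for n
        by (metis ennreal_add_diff_cancel_right infinity_ennreal_def)
      moreover have "(\<lambda>n. ?S - (\<Sum>i<n. ?\<mu> (R i))) \<longlonglongrightarrow> ?S - ?S"
        using sum_fin by (intro tendsto_diff_ennreal tendsto_const summable_LIMSEQ summableI) auto
      ultimately show "(\<lambda>n. \<Sum>i. ?\<mu> (R (i + n))) \<longlonglongrightarrow> 0"
        using sum_fin by simp
    qed
    ultimately show ?thesis
      using LIMSEQ_le_const by fastforce
  qed simp
  have "?\<mu> (A \<inter> F) + ?\<mu> (A - F) = ?\<mu> A" for A
    using key[of A] hausdorff_outer_Un[of s "A \<inter> F" "A - F"]
    by (intro antisym) (auto simp: Int_Diff_Un)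
  then show ?thesis
    using algebra.lambda_system_eq[OF algebra_Pow, of "UNIV :: 'a set" ?\<mu>] by simp
qed

lemma emeasure_hausdorff_measure:
  fixes A :: "'a::metric_space set"
  assumes "A \<in> sets borel"
  shows "emeasure (hausdorff_measure s) A = hausdorff_outer s A"
proof -
  let ?L = "lambda_system UNIV UNIV (hausdorff_outer s) :: 'a set set"
  have L: "measure_space UNIV ?L (hausdorff_outer s)"
    using sigma_algebra.caratheodory_lemma[OF sigma_algebra_Pow, of "UNIV :: 'a set"]
      outer_measure_space_hausdorff_outer by auto
  then have "sigma_algebra UNIV ?L" by (simp add: measure_space_def)
  then have "sigma_sets UNIV (Collect closed) \<subseteq> ?L"
    by (rule sigma_algebra.sigma_sets_subset)
       (auto intro: closed_in_lambda_system_hausdorff_outer)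
  then have "sets borel \<subseteq> ?L"
    by (simp add: borel_eq_closed)
  with L have "measure_space UNIV (sets borel) (hausdorff_outer s :: 'a set \<Rightarrow> _)"
    using sets.sigma_algebra_axioms[of borel] by (auto intro: measure_down)
  then show ?thesis
    unfolding hausdorff_measure_def using assms
    by (intro emeasure_measure_of_sigma) (auto simp: measure_space_def)
qed


section \<open>Star-regular polytopes\<close>

text \<open>
  A polytope here need not be convex: it is a finite union of full-dimensional convex polytopes.
\<close>

definition star_convex_polytope :: "'a::euclidean_space set \<Rightarrow> bool" where
  "star_convex_polytope K \<longleftrightarrow>
     starlike K \<and>
     (\<exists>P. finite P \<and> (\<forall>p\<in>P. polytope p \<and> interior p \<noteq> {}) \<and> K = \<Union>P)"

text \<open>
  \<open>n\<close> is the outward unit normal at the boundary point \<open>x\<close> if, near \<open>x\<close>, the set is the half-space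
  through \<open>x\<close> with outward normal \<open>n\<close>. For polytopes such points fill the boundary up to faces of
  codimension at least 2, where no normal exists.
\<close>

definition outward_unit_normal :: "'a::euclidean_space set \<Rightarrow> 'a \<Rightarrow> 'a \<Rightarrow> bool" where
  "outward_unit_normal K x n \<longleftrightarrow>
     x \<in> frontier K \<and> norm n = 1 \<and>
     (\<exists>r>0. \<forall>y\<in>ball x r. y \<in> K \<longleftrightarrow> n \<bullet> (y - x) \<le> 0)"

definition centered_star_regular_polytope :: "'a::euclidean_space set \<Rightarrow> bool" where
  "centered_star_regular_polytope K \<longleftrightarrow>
     star_convex_polytope K \<and>
     (\<exists>c. \<forall>x n. outward_unit_normal K x n \<longrightarrow> n \<bullet> x = c)"

definition isometries_of :: "'a::euclidean_space set \<Rightarrow> ('a \<Rightarrow> 'a) set" where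
  "isometries_of K = {f. (\<forall>x y. dist (f x) (f y) = dist x y) \<and> f ` K = K}"

definition isometry_orbit :: "'a::euclidean_space set \<Rightarrow> 'a \<Rightarrow> 'a set" where
  "isometry_orbit K x = {f x | f. f \<in> isometries_of K}"


section \<open>Averages, quadrature and the optimal interior weight\<close>

definition average :: "'a measure \<Rightarrow> 'a set \<Rightarrow> ('a \<Rightarrow> real) \<Rightarrow> real" where
  "average M A g = (LINT x:A|M. g x) / measure M A"

definition cell_average :: "'a::euclidean_space set \<Rightarrow> ('a \<Rightarrow> real) \<Rightarrow> real" where
  "cell_average K = average lborel K"

definition boundary_average :: "'a::euclidean_space set \<Rightarrow> ('a \<Rightarrow> real) \<Rightarrow> real" where
  "boundary_average K = average (hausdorff_measure (DIM('a) - 1)) (frontier K)"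

definition quadrature :: "'a set \<Rightarrow> ('a \<Rightarrow> real) \<Rightarrow> ('a \<Rightarrow> real) \<Rightarrow> real" where
  "quadrature Q b g = (\<Sum>x\<in>Q. b x * g x)"

definition boundary_quadrature ::
    "'a::euclidean_space set \<Rightarrow> ('a \<Rightarrow> real) set \<Rightarrow> 'a set \<Rightarrow> ('a \<Rightarrow> real) \<Rightarrow> bool" where
  "boundary_quadrature K V Q b \<longleftrightarrow>
     finite Q \<and> Q \<subseteq> frontier K \<and> (\<forall>x\<in>Q. 0 < b x) \<and>
     (\<forall>U\<in>V. quadrature Q b U = boundary_average K U)"

definition polynomials_degree_le_1 :: "('a::euclidean_space \<Rightarrow> real) set" where
  "polynomials_degree_le_1 = {\<lambda>x. c + (\<Sum>i\<in>Basis. a i * (x \<bullet> i)) | c a. True}"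

text \<open>The supremum is taken in the extended reals, so that an unbounded set has supremum \<open>\<infinity>\<close>.\<close>

definition optimal_interior_weight :: "'a::euclidean_space set \<Rightarrow> ('a \<Rightarrow> real) set \<Rightarrow> ereal" where
  "optimal_interior_weight K V =
     (SUP U\<in>{U \<in> V. (\<forall>x\<in>K. 0 \<le> U x) \<and> 0 < cell_average K U}.
        ereal (boundary_average K U / cell_average K U))"

end

theory Submission
  imports Defs
begin

text \<open>
  The isometries of \<open>K\<close> fix the origin, so they are linear. Each of them maps \<open>K\<close> and \<open>frontier K\<close>
  onto themselves and preserves volume and surface measure, hence it fixes the centroid of \<open>K\<close> and
  the centroid of \<open>frontier K\<close>. A fixed point is a singleton orbit, so both centroids are the
  origin. The average of an affine function is its value at the centroid; therefore the cell average
  and the boundary average of \<open>U\<close> are both \<open>U 0\<close> (\<open>average_affine_eq_value_at_origin\<close>). All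
  quotients in the definition of the optimal weight are then 1, and the cell average of \<open>U\<close> equals
  its quadrature over the boundary nodes, so that the Euler step subtracts at most
  \<open>lam * dt \<le> 1\<close> times a nonnegative number from that number.

  What remains is measure theory. Averages are divisions by a total measure, so the argument needs
  the volume of \<open>K\<close> and the area of \<open>frontier K\<close> to be positive and finite. For the area this is
  proved from the definition of Hausdorff measure by comparison with volume.

  \<^item> Finiteness (\<open>hausdorff_outer_frontier_convex_finite\<close>): separated points on the boundary of a
    convex body \<open>P\<close> carry disjoint balls of radius proportional to \<open>t\<close> inside the shell between
    \<open>(1 - t) P\<close> and \<open>(1 + t) P\<close>, whose volume is \<open>O(t)\<close>. So there are only \<open>O(t ^ (1 - D))\<close> of
    them, which bounds the cost of covering the boundary by balls of that size.
  \<^item> Positivity (\<open>hausdorff_outer_frontier_pos\<close>): stretching each member of a cover of the boundary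
    into a tube along a coordinate axis gives a cover of \<open>K\<close>, so a cheap cover of the boundary would
    force \<open>K\<close> to have small volume.
\<close>

section \<open>Invariance of the measures under isometries\<close>

text \<open>
  The uniqueness proof for Haar measure, run on \<open>lborel\<close> and its image under \<open>f\<close>: with \<open>B\<close> the unit
  ball, the double integral of \<open>indicator A x * indicator B (x - f y)\<close> is
  \<open>vol A * vol B\<close> when \<open>y\<close> is integrated first, because \<open>f\<close> maps balls to balls, and
  \<open>vol (f -` A) * vol B\<close> when \<open>x\<close> is, by translation invariance.
\<close>

lemma distr_lborel_orthogonal_transformation:
  fixes f :: "'a::euclidean_space \<Rightarrow> 'a"
  assumes f: "orthogonal_transformation f"
  shows "distr lborel borel f = lborel"
proof (rule measure_eqI)
  fix A assume "A \<in> sets (distr lborel borel f)"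
  then have A[measurable]: "A \<in> sets borel" by simp
  have f_meas[measurable]: "f \<in> borel_measurable borel"
    using f by (intro borel_measurable_continuous_onI linear_continuous_on)
      (auto simp: orthogonal_transformation_linear linear_conv_bounded_linear[symmetric])
  have f_dist: "dist (f x) (f y) = dist x y" for x y
    using f by (simp add: orthogonal_transformation_isometry)
  have f_add: "f (x + y) = f x + f y" for x y
    using f by (simp add: orthogonal_transformation_linear linear_add)
  obtain g where g: "\<And>x. f (g x) = x"
    using orthogonal_transformation_surj[OF f] by (metis surjD)
  define B :: "'a set" where "B = ball 0 1"
  have [measurable]: "B \<in> sets borel" by (simp add: B_def)
  define \<beta> where "\<beta> = emeasure lborel B"
  have \<beta>: "\<beta> \<noteq> 0" "\<beta> \<noteq> \<infinity>"
    using emeasure_lborel_ball_finite[of "0::'a" 1] unit_ball_vol_pos[of "real DIM('a)"]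
    unfolding \<beta>_def B_def by (simp_all add: emeasure_ball del: unit_ball_vol_pos)
  have shift: "(\<integral>\<^sup>+x. h (v + x) \<partial>lborel) = (\<integral>\<^sup>+x. h x \<partial>lborel)"
    if "h \<in> borel_measurable borel" for h :: "'a \<Rightarrow> ennreal" and v
    using that by (subst (2) lborel_distr_plus[of v, symmetric]) (simp add: nn_integral_distr)
  define I where "I = (\<integral>\<^sup>+x. \<integral>\<^sup>+y. indicator A x * indicator B (x - f y) \<partial>lborel \<partial>(lborel :: 'a measure))"
  have "(\<integral>\<^sup>+y. indicator A x * indicator B (x - f y) \<partial>lborel) = indicator A x * \<beta>" for x
  proof -
    \<comment> \<open>\<open>x - f y\<close> lies in the unit ball iff \<open>y\<close> lies in the unit ball around \<open>g x\<close>.\<close>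
    have "indicator B (x - f y) = (indicator (ball (g x) 1) y :: ennreal)" for y
      using f_dist[of "g x" y] by (simp add: B_def g dist_norm indicator_def norm_minus_commute)
    then have "(\<integral>\<^sup>+y. indicator A x * indicator B (x - f y) \<partial>lborel)
        = (\<integral>\<^sup>+y. indicator A x * indicator (ball (g x) 1) y \<partial>lborel)"
      by (simp only:)
    also have "\<dots> = indicator A x * \<beta>"
      by (subst nn_integral_cmult_indicator) (simp_all add: \<beta>_def B_def emeasure_ball)
    finally show ?thesis .
  qed
  then have I1: "I = emeasure lborel A * \<beta>"
    unfolding I_def by (simp add: nn_integral_multc)
  have "I = (\<integral>\<^sup>+y. \<integral>\<^sup>+x. indicator A x * indicator B (x - f y) \<partial>lborel \<partial>(lborel :: 'a measure))"
    unfolding I_def by (rule lborel_pair.Fubini') measurable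
  also have "\<dots> = (\<integral>\<^sup>+y. \<integral>\<^sup>+x. indicator A (f y + x) * indicator B x \<partial>lborel \<partial>(lborel :: 'a measure))"
  proof (rule nn_integral_cong)
    fix y
    show "(\<integral>\<^sup>+x. indicator A x * indicator B (x - f y) \<partial>lborel)
        = (\<integral>\<^sup>+x. indicator A (f y + x) * indicator B x \<partial>lborel)"
      by (subst shift[where v = "f y", symmetric]) simp_all
  qed
  also have "\<dots> = (\<integral>\<^sup>+x. \<integral>\<^sup>+y. indicator A (f y + x) * indicator B x \<partial>lborel \<partial>(lborel :: 'a measure))"
    by (rule lborel_pair.Fubini') measurable
  also have "\<dots> = (\<integral>\<^sup>+x. emeasure lborel (f -` A) * indicator B x \<partial>(lborel :: 'a measure))"
  proof (rule nn_integral_cong)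
    fix x :: 'a
    have [measurable]: "f -` A \<in> sets borel"
      using measurable_sets[OF f_meas A] by simp
    have "(\<integral>\<^sup>+y. indicator A (f y + x) * indicator B x \<partial>lborel)
        = (\<integral>\<^sup>+y. indicator (f -` A) (g x + y) \<partial>lborel) * indicator B x"
      by (subst nn_integral_multc[symmetric])
        (auto intro!: nn_integral_cong simp: f_add g add.commute indicator_def)
    also have "\<dots> = emeasure lborel (f -` A) * indicator B x"
      by (subst shift) simp_all
    finally show "(\<integral>\<^sup>+y. indicator A (f y + x) * indicator B x \<partial>lborel)
        = emeasure lborel (f -` A) * indicator B x" .
  qed
  also have "\<dots> = emeasure lborel (f -` A) * \<beta>"
    by (simp add: nn_integral_cmult \<beta>_def)
  finally have "emeasure lborel (f -` A) = emeasure lborel A"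
    using I1 \<beta> by (simp add: ennreal_mult_cancel_left mult.commute[of _ \<beta>])
  then show "emeasure (distr lborel borel f) A = emeasure lborel A"
    by (simp add: emeasure_distr)
qed simp

lemma hausdorff_gauge_isometry_image:
  assumes f: "\<And>x y. dist (f x) (f y) = dist x y"
  shows "hausdorff_gauge s \<delta> (f ` C) = hausdorff_gauge s \<delta> C"
proof -
  have b: "bounded (f ` C) \<longleftrightarrow> bounded C"
    unfolding bounded_two_points by (auto simp: f)
  have "(\<lambda>(x, y). dist x y) ` (f ` C \<times> f ` C) = (\<lambda>(x, y). dist x y) ` (C \<times> C)"
    by (force simp: f)
  then have "diameter (f ` C) = diameter C"
    by (simp add: diameter_def)
  with b show ?thesis by (simp add: hausdorff_gauge_def)
qed

lemma hausdorff_outer_isometry_image_le: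
  assumes f: "\<And>x y. dist (f x) (f y) = dist x y"
  shows "hausdorff_outer s (f ` A) \<le> hausdorff_outer s A"
proof -
  have "outer_measure UNIV (hausdorff_gauge s \<delta>) (f ` A)
      \<le> outer_measure UNIV (hausdorff_gauge s \<delta>) A" for \<delta>
    unfolding outer_measure_hausdorff_gauge_eq_INF
  proof (rule INF_greatest)
    fix C :: "nat \<Rightarrow> 'a set" assume C: "C \<in> {C. A \<subseteq> (\<Union>i. C i)}"
    have "(INF C\<in>{C :: nat \<Rightarrow> 'b set. f ` A \<subseteq> (\<Union>i. C i)}. \<Sum>i. hausdorff_gauge s \<delta> (C i))
        \<le> (\<Sum>i. hausdorff_gauge s \<delta> (f ` C i))"
      using C by (intro INF_lower) blast
    then show "(INF C\<in>{C :: nat \<Rightarrow> 'b set. f ` A \<subseteq> (\<Union>i. C i)}. \<Sum>i. hausdorff_gauge s \<delta> (C i))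
        \<le> (\<Sum>i. hausdorff_gauge s \<delta> (C i))"
      by (simp add: hausdorff_gauge_isometry_image[OF f])
  qed
  then show ?thesis unfolding hausdorff_outer_def by (intro SUP_mono) auto
qed

text \<open>
  The images under \<open>f\<close> of a cover of \<open>A\<close> cover \<open>f ` A\<close> at the same cost. Conversely the preimages of
  a cover of \<open>f ` A\<close> cover \<open>A\<close>, and they cost no more because their images are subsets of the
  given sets.
\<close>

lemma hausdorff_outer_isometry_image:
  assumes f: "\<And>x y. dist (f x) (f y) = dist x y"
  shows "hausdorff_outer s (f ` A) = hausdorff_outer s A"
proof (rule antisym)
  have "outer_measure UNIV (hausdorff_gauge s \<delta>) A
      \<le> outer_measure UNIV (hausdorff_gauge s \<delta>) (f ` A)" for \<delta>
    unfolding outer_measure_hausdorff_gauge_eq_INF[of s \<delta> "f ` A"]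
  proof (rule INF_greatest)
    fix C :: "nat \<Rightarrow> 'b set" assume C: "C \<in> {C. f ` A \<subseteq> (\<Union>i. C i)}"
    have "outer_measure UNIV (hausdorff_gauge s \<delta>) A \<le> (\<Sum>i. hausdorff_gauge s \<delta> (f -` C i))"
      unfolding outer_measure_hausdorff_gauge_eq_INF using C by (intro INF_lower) blast
    also have "\<dots> \<le> (\<Sum>i. hausdorff_gauge s \<delta> (C i))"
    proof (intro suminf_le summableI)
      fix i
      have "hausdorff_gauge s \<delta> (f -` C i) = hausdorff_gauge s \<delta> (f ` (f -` C i))"
        by (rule hausdorff_gauge_isometry_image[OF f, symmetric])
      also have "\<dots> \<le> hausdorff_gauge s \<delta> (C i)"
        by (rule increasingD[OF increasing_hausdorff_gauge]) auto
      finally show "hausdorff_gauge s \<delta> (f -` C i) \<le> hausdorff_gauge s \<delta> (C i)" .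
    qed
    finally show "outer_measure UNIV (hausdorff_gauge s \<delta>) A \<le> (\<Sum>i. hausdorff_gauge s \<delta> (C i))" .
  qed
  then show "hausdorff_outer s A \<le> hausdorff_outer s (f ` A)"
    unfolding hausdorff_outer_def by (intro SUP_mono) auto
qed (rule hausdorff_outer_isometry_image_le[OF f])

lemma distr_hausdorff_measure_isometry:
  fixes f :: "'a::metric_space \<Rightarrow> 'a"
  assumes f: "\<And>x y. dist (f x) (f y) = dist x y" and "surj f"
  shows "distr (hausdorff_measure s) borel f = hausdorff_measure s"
proof (rule measure_eqI)
  fix A assume "A \<in> sets (distr (hausdorff_measure s) borel f)"
  then have A: "A \<in> sets borel" by simp
  have "continuous_on UNIV f"
    unfolding continuous_on_iff by (auto simp: f)
  then have m: "f \<in> borel_measurable borel"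
    by (rule borel_measurable_continuous_onI)
  have "hausdorff_outer s (f -` A) = hausdorff_outer s (f ` (f -` A))"
    by (rule hausdorff_outer_isometry_image[OF f, symmetric])
  also have "f ` (f -` A) = A"
    using \<open>surj f\<close> by (simp add: surj_image_vimage_eq)
  finally show "emeasure (distr (hausdorff_measure s) borel f) A = emeasure (hausdorff_measure s) A"
    using A measurable_sets[OF m A] m
    by (simp add: emeasure_distr emeasure_hausdorff_measure measurable_def)
qed simp

section \<open>The boundary has finite area\<close>

text \<open>
  The volume of the shell between \<open>(1 - t) P\<close> and \<open>(1 + t) P\<close>, relative to that of \<open>P\<close>, is of first
  order in \<open>t\<close>.
\<close>

lemma power_shell_bound: "\<exists>C\<ge>0. \<forall>t\<in>{0..1}. (1 + t) ^ n - (1 - t) ^ n \<le> C * (t::real)"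
proof (induction n)
  case (Suc n)
  then obtain C :: real
    where C: "C \<ge> 0" "\<forall>t\<in>{0..1}. (1 + t) ^ n - (1 - t) ^ n \<le> C * t"
    by (elim exE conjE)
  have "(1 + t) ^ Suc n - (1 - t) ^ Suc n \<le> (2 * C + 2) * t" if t: "t \<in> {0..1}" for t
  proof -
    have "(1 + t) ^ Suc n - (1 - t) ^ Suc n
        = (1 + t) * ((1 + t) ^ n - (1 - t) ^ n) + 2 * t * (1 - t) ^ n"
      by (simp add: algebra_simps)
    also have "\<dots> \<le> 2 * (C * t) + 2 * t * 1"
    proof (rule add_mono)
      have "(1 - t) ^ n \<le> (1 + t) ^ n" using t by (intro power_mono) auto
      then show "(1 + t) * ((1 + t) ^ n - (1 - t) ^ n) \<le> 2 * (C * t)"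
        using t bspec[OF C(2) t] by (intro mult_mono) auto
      show "2 * t * (1 - t) ^ n \<le> 2 * t * 1"
        using t by (intro mult_left_mono power_le_one) auto
    qed
    finally show ?thesis by (simp add: algebra_simps)
  qed
  with C(1) show ?case by (intro exI[of _ "2 * C + 2"]) auto
qed (auto intro: exI[of _ 0])

text \<open>
  A point near \<open>x\<close> is \<open>x + t u\<close> with \<open>u\<close> and \<open>- u\<close> in the ball inside \<open>P\<close>. Convexity puts it into
  \<open>P + t P = (1 + t) P\<close>. If it were \<open>(1 - t) p\<close> with \<open>p\<close> in \<open>P\<close>, then \<open>x = (1 - t) p + t (- u)\<close>
  would be a proper convex combination of a point of \<open>P\<close> and an interior point, hence interior.
\<close>

lemma ball_frontier_convex_subset_shell:
  fixes P :: "'a::euclidean_space set"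
  assumes P: "convex P" "closed P" and r: "0 < r" "ball 0 r \<subseteq> P"
    and t: "0 < t" "t < 1" and x: "x \<in> frontier P"
  shows "ball x (r * t) \<subseteq> (\<lambda>p. (1 + t) *\<^sub>R p) ` P - (\<lambda>p. (1 - t) *\<^sub>R p) ` P"
proof
  fix y assume "y \<in> ball x (r * t)"
  define u where "u = (y - x) /\<^sub>R t"
  have y: "y = x + t *\<^sub>R u" using t by (simp add: u_def)
  have "norm u < r"
    using \<open>y \<in> ball x (r * t)\<close> t
    by (simp add: u_def dist_norm norm_minus_commute divide_simps flip: divide_inverse_commute)
  then have u: "u \<in> ball 0 r" "- u \<in> ball 0 r" by auto
  have "x \<in> P" using x P(2) by (simp add: frontier_def)
  have "(1 / (1 + t)) *\<^sub>R x + (t / (1 + t)) *\<^sub>R u \<in> P"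
    using t u r \<open>x \<in> P\<close> by (intro convexD[OF P(1)]) (auto simp: field_simps)
  moreover have "y = (1 + t) *\<^sub>R ((1 / (1 + t)) *\<^sub>R x + (t / (1 + t)) *\<^sub>R u)"
    using t by (simp add: y scaleR_add_right)
  ultimately have 1: "y \<in> (\<lambda>p. (1 + t) *\<^sub>R p) ` P" by blast
  have 2: "y \<notin> (\<lambda>p. (1 - t) *\<^sub>R p) ` P"
  proof
    assume "y \<in> (\<lambda>p. (1 - t) *\<^sub>R p) ` P"
    then obtain p where p: "p \<in> P" "y = (1 - t) *\<^sub>R p" by auto
    have "- u \<in> interior P" using u(2) r(2) open_ball interior_maximal by blast
    then have "p - t *\<^sub>R (p - (- u)) \<in> interior P"
      using t p by (intro mem_interior_convex_shrink[OF P(1)]) auto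
    also have "p - t *\<^sub>R (p - (- u)) = x" using p(2) y by (simp add: algebra_simps)
    finally show False using x by (simp add: frontier_def)
  qed
  from 1 2 show "y \<in> (\<lambda>p. (1 + t) *\<^sub>R p) ` P - (\<lambda>p. (1 - t) *\<^sub>R p) ` P" by blast
qed

lemma measure_shell:
  fixes P :: "'a::euclidean_space set"
  assumes P: "convex P" "compact P" "0 \<in> P" and t: "0 < t" "t < 1"
  defines "S \<equiv> (\<lambda>p. (1 + t) *\<^sub>R p) ` P - (\<lambda>p. (1 - t) *\<^sub>R p) ` P"
  shows "S \<in> lmeasurable"
    and "measure lebesgue S = ((1 + t) ^ DIM('a) - (1 - t) ^ DIM('a)) * measure lebesgue P"
proof -
  have c: "compact ((\<lambda>p. c *\<^sub>R p) ` P)" for c using P(2) by (rule compact_scaling)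
  have sub: "(\<lambda>p. (1 - t) *\<^sub>R p) ` P \<subseteq> (\<lambda>p. (1 + t) *\<^sub>R p) ` P"
  proof clarify
    fix p assume "p \<in> P"
    have q: "(1 + t) * ((1 - t) / (1 + t)) = 1 - t" "0 \<le> (1 - t) / (1 + t)" "(1 - t) / (1 + t) \<le> 1"
      using t by simp_all
    have "((1 - t) / (1 + t)) *\<^sub>R p + (1 - (1 - t) / (1 + t)) *\<^sub>R 0 \<in> P"
      using q P(3) \<open>p \<in> P\<close> by (intro convexD[OF P(1)]) simp_all
    moreover have "(1 - t) *\<^sub>R p = (1 + t) *\<^sub>R ((1 - t) / (1 + t)) *\<^sub>R p"
      by (simp only: scaleR_scaleR q(1))
    ultimately show "(1 - t) *\<^sub>R p \<in> (\<lambda>p. (1 + t) *\<^sub>R p) ` P"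
      by (metis add.right_neutral image_eqI scaleR_zero_right)
  qed
  show "S \<in> lmeasurable" unfolding S_def using c by (intro fmeasurable.Diff lmeasurable_compact)
  have "measure lebesgue ((\<lambda>p. c *\<^sub>R p) ` P) = \<bar>c\<bar> ^ DIM('a) * measure lebesgue P" for c
    using measure_lebesgue_affine[of c 0 P] by simp
  then show "measure lebesgue S = ((1 + t) ^ DIM('a) - (1 - t) ^ DIM('a)) * measure lebesgue P"
    unfolding S_def using t
    by (subst measurable_measure_Diff[OF lmeasurable_compact[OF c] fmeasurableD[OF lmeasurable_compact[OF c]] sub])
      (simp add: left_diff_distrib)
qed

text \<open>
  The balls of radius \<open>r t\<close> around the points of \<open>S\<close> are disjoint and lie in the shell, whose volume
  is \<open>O(t)\<close>; each has volume of order \<open>t ^ D\<close>.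
\<close>

lemma card_separated_frontier_convex:
  fixes P :: "'a::euclidean_space set"
  assumes P: "convex P" "compact P" and r: "0 < r" "ball 0 r \<subseteq> P"
  shows "\<exists>C. \<forall>t S. 0 < t \<longrightarrow> t < 1 \<longrightarrow> finite S \<longrightarrow> S \<subseteq> frontier P \<longrightarrow>
           (\<forall>x\<in>S. \<forall>y\<in>S. x \<noteq> y \<longrightarrow> 2 * r * t \<le> dist x y) \<longrightarrow>
           real (card S) * t ^ (DIM('a) - 1) \<le> C"
proof -
  obtain C0 where C0: "C0 \<ge> 0"
      "\<And>t. t \<in> {0..1} \<Longrightarrow> (1 + t) ^ DIM('a) - (1 - t) ^ DIM('a) \<le> C0 * (t::real)"
    using power_shell_bound[of "DIM('a)"] by blast
  define \<beta> where "\<beta> = measure lebesgue (ball (0::'a) 1)"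
  have \<beta>: "\<beta> > 0" by (simp add: \<beta>_def)
  define v where "v = measure lebesgue P"
  have "real (card S) * t ^ (DIM('a) - 1) \<le> C0 * v / (r ^ DIM('a) * \<beta>)"
    if t: "0 < t" "t < 1" and S: "finite S" "S \<subseteq> frontier P"
      and sep: "\<forall>x\<in>S. \<forall>y\<in>S. x \<noteq> y \<longrightarrow> 2 * r * t \<le> dist x y" for t S
  proof -
    let ?Sh = "(\<lambda>p. (1 + t) *\<^sub>R p) ` P - (\<lambda>p. (1 - t) *\<^sub>R p) ` P"
    have "0 \<in> P" using r by auto
    note sh = measure_shell[OF P \<open>0 \<in> P\<close> t]
    have disj: "disjoint_family_on (\<lambda>x. ball x (r * t)) S"
      unfolding disjoint_family_on_def
    proof (intro ballI impI)
      fix x y assume "x \<in> S" "y \<in> S" "x \<noteq> y"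
      then have "2 * r * t \<le> dist x y" using sep by auto
      then show "ball x (r * t) \<inter> ball y (r * t) = {}"
        by (intro disjoint_ballI) simp
    qed
    have "real (card S) * ((r * t) ^ DIM('a) * \<beta>) = (\<Sum>x\<in>S. measure lebesgue (ball x (r * t)))"
      using r t by (simp add: \<beta>_def content_ball_conv_unit_ball[of "r * t"])
    also have "\<dots> = measure lebesgue (\<Union>x\<in>S. ball x (r * t))"
      using S disj by (intro measure_UNION'[symmetric])
        (auto simp: disjoint_family_on_def pairwise_def disjnt_def)
    also have "\<dots> \<le> measure lebesgue ?Sh"
      using ball_frontier_convex_subset_shell[OF P(1) compact_imp_closed[OF P(2)] r t] S sh(1)
      by (intro measure_mono_fmeasurable) (auto simp: fmeasurableD subset_iff)
    also have "\<dots> \<le> C0 * t * v"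
      unfolding sh(2) v_def[symmetric] using C0(2)[of t] t
      by (intro mult_right_mono) (auto simp: v_def)
    finally have "real (card S) * ((r * t) ^ DIM('a) * \<beta>) \<le> C0 * t * v" .
    moreover have "t ^ DIM('a) = t * t ^ (DIM('a) - 1)"
      by (metis DIM_positive power_eq_if less_numeral_extra(3))
    ultimately have "t * (real (card S) * t ^ (DIM('a) - 1) * (r ^ DIM('a) * \<beta>)) \<le> t * (C0 * v)"
      by (simp add: power_mult_distrib algebra_simps)
    then show ?thesis
      using t r \<beta> by (simp add: field_simps)
  qed
  then show ?thesis by blast
qed

text \<open>
  A separated set of maximal cardinality is a net: a point farther than \<open>e\<close> from all its members
  could be added to it.
\<close>

lemma maximal_separated_net:
  fixes A :: "'a::metric_space set"
  assumes "0 \<le> e"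
    and bound: "\<And>S. finite S \<Longrightarrow> S \<subseteq> A \<Longrightarrow> (\<forall>x\<in>S. \<forall>y\<in>S. x \<noteq> y \<longrightarrow> e \<le> dist x y) \<Longrightarrow> card S \<le> N"
  obtains S where "finite S" "S \<subseteq> A" "\<forall>x\<in>S. \<forall>y\<in>S. x \<noteq> y \<longrightarrow> e \<le> dist x y"
    "A \<subseteq> (\<Union>x\<in>S. cball x e)"
proof -
  define G where "G S \<longleftrightarrow> finite S \<and> S \<subseteq> A \<and> (\<forall>x\<in>S. \<forall>y\<in>S. x \<noteq> y \<longrightarrow> e \<le> dist x y)" for S
  have "G {}" by (simp add: G_def)
  moreover have "\<forall>T. G T \<longrightarrow> card T < Suc N" using bound by (simp add: G_def less_Suc_eq_le)
  ultimately have "\<exists>S. G S \<and> (\<forall>T. G T \<longrightarrow> card T \<le> card S)"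
    by (rule ex_has_greatest_nat[where P = G and f = card])
  then obtain S where S: "G S" and max: "\<And>T. G T \<Longrightarrow> card T \<le> card S" by blast
  have "A \<subseteq> (\<Union>x\<in>S. cball x e)"
  proof
    fix a assume a: "a \<in> A"
    show "a \<in> (\<Union>x\<in>S. cball x e)"
    proof (rule ccontr)
      assume far: "a \<notin> (\<Union>x\<in>S. cball x e)"
      have "a \<notin> S" using far \<open>0 \<le> e\<close> by force
      moreover have "G (insert a S)"
        using S a far by (auto simp: G_def dist_commute not_le less_imp_le)
      then have "card (insert a S) \<le> card S" by (rule max)
      ultimately show False using S by (simp add: G_def)
    qed
  qed
  then show thesis using S that by (auto simp: G_def)
qed

lemma hausdorff_outer_le_of_finite_covers:
  fixes A :: "'a::euclidean_space set"
  assumes "\<And>\<delta>. 0 < \<delta> \<Longrightarrow> \<exists>S \<rho>. finite S \<and> 0 < \<rho> \<and> 2 * \<rho> \<le> \<delta> \<and> A \<subseteq> (\<Union>x\<in>S. cball x \<rho>) \<and>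
      real (card S) * \<rho> ^ s \<le> C"
  shows "hausdorff_outer s A \<le> ennreal (unit_ball_vol s * C)"
  unfolding hausdorff_outer_def
proof (rule SUP_least)
  fix \<delta> :: real assume "\<delta> \<in> {0<..}"
  then obtain S \<rho> where S: "finite S" "0 < \<rho>" "2 * \<rho> \<le> \<delta>" "A \<subseteq> (\<Union>x\<in>S. cball x \<rho>)"
      "real (card S) * \<rho> ^ s \<le> C"
    using assms by (metis greaterThan_iff)
  obtain h where h: "bij_betw h {..<card S} S"
    using ex_bij_betw_nat_finite[OF S(1)] by (auto simp: atLeast0LessThan)
  define B where "B i = (if i < card S then cball (h i) \<rho> else {})" for i
  have cov: "A \<subseteq> (\<Union>i. B i)"
  proof
    fix a assume "a \<in> A"
    then obtain x where x: "x \<in> S" "a \<in> cball x \<rho>" using S(4) by auto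
    then obtain i where "i < card S" "x = h i" using h by (auto simp: bij_betw_def)
    with x show "a \<in> (\<Union>i. B i)" by (auto simp: B_def)
  qed
  have g: "hausdorff_gauge s \<delta> (cball x \<rho>) \<le> ennreal (unit_ball_vol s * \<rho> ^ s)" for x :: 'a
  proof -
    have d: "diameter (cball x \<rho>) \<le> 2 * \<rho>"
      using S(2) diameter_cball[of x \<rho>] by simp
    have d0: "0 \<le> diameter (cball x \<rho>)" by (rule diameter_ge_0) simp
    have "unit_ball_vol s * (diameter (cball x \<rho>) / 2) ^ s \<le> unit_ball_vol s * \<rho> ^ s"
      using d d0 by (intro mult_left_mono power_mono) auto
    then show ?thesis using d S by (auto simp: hausdorff_gauge_def intro: ennreal_leI)
  qed
  have "outer_measure UNIV (hausdorff_gauge s \<delta>) A \<le> (\<Sum>i. hausdorff_gauge s \<delta> (B i))"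
    unfolding outer_measure_hausdorff_gauge_eq_INF using cov by (intro INF_lower) auto
  also have "\<dots> = (\<Sum>i<card S. hausdorff_gauge s \<delta> (B i))"
    by (intro suminf_finite) (auto simp: B_def hausdorff_gauge_def)
  also have "\<dots> \<le> (\<Sum>i<card S. ennreal (unit_ball_vol s * \<rho> ^ s))"
    using g by (intro sum_mono) (auto simp: B_def)
  also have "\<dots> = ennreal (unit_ball_vol s * (real (card S) * \<rho> ^ s))"
    by (simp add: ennreal_of_nat_eq_real_of_nat ennreal_mult'[symmetric] ac_simps)
  also have "\<dots> \<le> ennreal (unit_ball_vol s * C)"
    using S(5) by (intro ennreal_leI mult_left_mono) auto
  finally show "outer_measure UNIV (hausdorff_gauge s \<delta>) A \<le> ennreal (unit_ball_vol s * C)" .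
qed

text \<open>
  Maximal separated subsets of the boundary are the centres of covers by balls, and their number is
  bounded by \<open>card_separated_frontier_convex\<close>. Translating an interior point of \<open>P\<close> to the origin
  makes the dilates of \<open>P\<close> nested.
\<close>

lemma hausdorff_outer_frontier_convex_finite:
  fixes P :: "'a::euclidean_space set"
  assumes P: "convex P" "compact P" "interior P \<noteq> {}"
  shows "hausdorff_outer (DIM('a) - 1) (frontier P) < \<infinity>"
proof -
  obtain z where "z \<in> interior P" using P by auto
  define P' where "P' = (+) (- z) ` P"
  have "0 \<in> interior P'"
    unfolding P'_def interior_translation using \<open>z \<in> interior P\<close> by force
  then obtain r where r: "0 < r" "ball 0 r \<subseteq> P'" unfolding mem_interior by blast
  have P': "convex P'" "compact P'"
    using P unfolding P'_def by (auto intro!: convex_translation compact_translation simp del: add_uminus_conv_diff uminus_add_conv_diff)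
  let ?s = "DIM('a) - 1"
  obtain C where C: "\<And>t S. 0 < t \<Longrightarrow> t < 1 \<Longrightarrow> finite S \<Longrightarrow> S \<subseteq> frontier P' \<Longrightarrow>
      (\<forall>x\<in>S. \<forall>y\<in>S. x \<noteq> y \<longrightarrow> 2 * r * t \<le> dist x y) \<Longrightarrow> real (card S) * t ^ ?s \<le> C"
    using card_separated_frontier_convex[OF P' r] by blast
  have "hausdorff_outer ?s (frontier P') \<le> ennreal (unit_ball_vol ?s * ((2 * r) ^ ?s * C))"
  proof (rule hausdorff_outer_le_of_finite_covers)
    fix \<delta> :: real assume "0 < \<delta>"
    \<comment> \<open>Balls of radius \<open>2 * r * t\<close> must have diameter at most \<open>\<delta>\<close>.\<close>
    define t where "t = min (1 / 2) (\<delta> / (4 * r))"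
    have t: "0 < t" "t < 1" using \<open>0 < \<delta>\<close> r by (auto simp: t_def)
    have "4 * r * t \<le> 4 * r * (\<delta> / (4 * r))" using r by (intro mult_left_mono) (auto simp: t_def)
    then have t\<delta>: "2 * (2 * r * t) \<le> \<delta>" using r by simp
    have cb: "card S \<le> nat \<lceil>C / t ^ ?s\<rceil>" if "finite S" "S \<subseteq> frontier P'"
      "\<forall>x\<in>S. \<forall>y\<in>S. x \<noteq> y \<longrightarrow> 2 * r * t \<le> dist x y" for S
    proof -
      have "real (card S) \<le> C / t ^ ?s" using C[OF t that] t by (simp add: field_simps)
      then show ?thesis by linarith
    qed
    have "0 \<le> 2 * r * t" using r t by simp
    then obtain S where S: "finite S" "S \<subseteq> frontier P'"
      "\<forall>x\<in>S. \<forall>y\<in>S. x \<noteq> y \<longrightarrow> 2 * r * t \<le> dist x y"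
      "frontier P' \<subseteq> (\<Union>x\<in>S. cball x (2 * r * t))"
      using cb by (rule maximal_separated_net)
    have "real (card S) * (2 * r * t) ^ ?s = (2 * r) ^ ?s * (real (card S) * t ^ ?s)"
      by (simp add: power_mult_distrib)
    also have "\<dots> \<le> (2 * r) ^ ?s * C"
      using C[OF t S(1,2,3)] r by (intro mult_left_mono) auto
    finally show "\<exists>S \<rho>. finite S \<and> 0 < \<rho> \<and> 2 * \<rho> \<le> \<delta> \<and> frontier P' \<subseteq> (\<Union>x\<in>S. cball x \<rho>) \<and>
        real (card S) * \<rho> ^ ?s \<le> (2 * r) ^ ?s * C"
      using S t r t\<delta> by (intro exI[of _ S] exI[of _ "2 * r * t"]) auto
  qed
  also have "hausdorff_outer ?s (frontier P') = hausdorff_outer ?s (frontier P)"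
    unfolding P'_def frontier_translation by (rule hausdorff_outer_isometry_image) (simp only: dist_add_cancel)
  finally show ?thesis by (simp add: order_le_less_trans)
qed

lemma hausdorff_outer_frontier_Union_finite:
  fixes F :: "'a::euclidean_space set set"
  assumes "finite F" and "\<And>P. P \<in> F \<Longrightarrow> convex P \<and> compact P \<and> interior P \<noteq> {}"
  shows "hausdorff_outer (DIM('a) - 1) (frontier (\<Union>F)) < \<infinity>"
  using assms
proof (induction F)
  case (insert P F)
  let ?H = "hausdorff_outer (DIM('a) - 1) :: 'a set \<Rightarrow> ennreal"
  have "?H (frontier (\<Union>(insert P F))) \<le> ?H (frontier P \<union> frontier (\<Union>F))"
    unfolding Union_insert by (intro hausdorff_outer_mono frontier_Un_subset)
  also have "\<dots> \<le> ?H (frontier P) + ?H (frontier (\<Union>F))" by (rule hausdorff_outer_Un)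
  also have "\<dots> < \<infinity>"
    using insert hausdorff_outer_frontier_convex_finite[of P] by simp
  finally show ?case .
qed simp

section \<open>The boundary has positive area\<close>

text \<open>
  Moving from a point of \<open>K\<close> in the direction \<open>e\<close> one leaves the bounded set \<open>K\<close> through its
  frontier. So if the sets \<open>C i\<close> cover the frontier, then the boxes \<open>T i\<close> with axis through a point
  of \<open>C i\<close>, of length \<open>2 R\<close> in the direction \<open>e\<close> and side \<open>2 * diameter (C i)\<close> in the others,
  cover \<open>K\<close>. The volume of such a box is a constant \<open>c\<close> times the gauge of \<open>C i\<close>, whence the volume of \<open>K\<close> is at most
  \<open>c\<close> times the cost of any cover.
\<close>

lemma hausdorff_outer_frontier_pos:
  fixes K :: "'a::euclidean_space set"
  assumes K: "bounded K" "0 < emeasure lborel K"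
  shows "0 < hausdorff_outer (DIM('a) - 1) (frontier K)"
proof -
  obtain e :: 'a where e: "e \<in> Basis" using nonempty_Basis by blast
  obtain R where R: "0 < R" "\<And>x. x \<in> K \<Longrightarrow> norm x \<le> R"
    using K(1) bounded_pos by blast
  have Re: "\<bar>x \<bullet> e\<bar> \<le> R" if "x \<in> K" for x
    using R(2)[OF that] Basis_le_norm[OF e, of x] by linarith
  define s where "s = DIM('a) - 1"
  \<comment> \<open>Chosen so that \<open>c\<close> times the gauge \<open>unit_ball_vol s * (d / 2) ^ s\<close> is \<open>2 * R * (2 * d) ^ s\<close>.\<close>
  define c where "c = 2 * R * 4 ^ s / unit_ball_vol s"
  have c: "0 < c" using R(1) by (simp add: c_def)
  have meets: "\<exists>z\<in>frontier K. \<forall>j\<in>Basis - {e}. z \<bullet> j = y \<bullet> j" if "y \<in> K" for y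
  proof -
    let ?w = "y + (2 * R + 1) *\<^sub>R e"
    have "?w \<bullet> e = y \<bullet> e + 2 * R + 1" using e by (simp add: inner_add_left)
    then have "?w \<notin> K" using Re[of ?w] Re[OF that] by auto
    then have "closed_segment y ?w \<inter> frontier K \<noteq> {}"
      using that by (intro connected_Int_frontier) auto
    then obtain z where z: "z \<in> closed_segment y ?w" "z \<in> frontier K" by blast
    then obtain u where "z = (1 - u) *\<^sub>R y + u *\<^sub>R ?w" by (auto simp: in_segment)
    then have "z = y + (u * (2 * R + 1)) *\<^sub>R e" by (simp add: algebra_simps)
    then have "\<forall>j\<in>Basis - {e}. z \<bullet> j = y \<bullet> j"
      using e by (auto simp: inner_add_left inner_Basis)
    with z show ?thesis by blast
  qed
  have main: "emeasure lborel K \<le> ennreal c * (\<Sum>i. hausdorff_gauge s 1 (C i))"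
    if C: "frontier K \<subseteq> (\<Union>i. C i)" for C :: "nat \<Rightarrow> 'a set"
  proof -
    \<comment> \<open>Sets of infinite gauge get \<open>UNIV\<close>: the volume bound for them is trivial.\<close>
    define T where "T i = (if C i = {} then {} else
        if bounded (C i) \<and> diameter (C i) \<le> 1 then
          cbox (\<Sum>j\<in>Basis. (if j = e then - R else (SOME x. x \<in> C i) \<bullet> j - diameter (C i)) *\<^sub>R j)
               (\<Sum>j\<in>Basis. (if j = e then R else (SOME x. x \<in> C i) \<bullet> j + diameter (C i)) *\<^sub>R j)
        else UNIV)" for i
    have "K \<subseteq> (\<Union>i. T i)"
    proof
      fix y assume y: "y \<in> K"
      obtain z where z: "z \<in> frontier K" "\<And>j. j \<in> Basis \<Longrightarrow> j \<noteq> e \<Longrightarrow> z \<bullet> j = y \<bullet> j"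
        using meets[OF y] by auto
      obtain i where i: "z \<in> C i" using z C by blast
      define x where "x = (SOME x. x \<in> C i)"
      have x: "x \<in> C i" unfolding x_def using i by (rule someI)
      have "y \<in> T i"
      proof (cases "bounded (C i) \<and> diameter (C i) \<le> 1")
        case True
        have "\<bar>z \<bullet> j - x \<bullet> j\<bar> \<le> diameter (C i)" if "j \<in> Basis" for j
        proof -
          have "\<bar>(z - x) \<bullet> j\<bar> \<le> norm (z - x)" using that by (rule Basis_le_norm)
          also have "\<dots> \<le> diameter (C i)"
            using diameter_bounded_bound[of "C i" z x] True i x by (simp add: dist_norm)
          finally show ?thesis by (simp add: inner_diff_left)
        qed
        then have "\<bar>y \<bullet> j - x \<bullet> j\<bar> \<le> diameter (C i)" if "j \<in> Basis" "j \<noteq> e" for j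
          using z(2) that by metis
        then show ?thesis
          using True i Re[OF y] unfolding T_def x_def[symmetric]
          by (auto simp: mem_box abs_le_iff) (smt (verit))+
      next
        case False
        with i show ?thesis by (auto simp: T_def)
      qed
      then show "y \<in> (\<Union>i. T i)" by blast
    qed
    have Tm: "T i \<in> sets borel" for i by (auto simp: T_def)
    have Tg: "emeasure lborel (T i) \<le> ennreal c * hausdorff_gauge s 1 (C i)" for i
    proof -
      consider "C i = {}" | "C i \<noteq> {}" "bounded (C i) \<and> diameter (C i) \<le> 1"
        | "C i \<noteq> {}" "\<not> (bounded (C i) \<and> diameter (C i) \<le> 1)" by blast
      then show ?thesis
      proof cases
        case 2
        define d where "d = diameter (C i)"
        have d: "0 \<le> d" using 2 by (simp add: d_def diameter_ge_0)
        define x where "x = (SOME x. x \<in> C i)"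
        define u where "u = (\<Sum>j\<in>Basis. (if j = e then R else x \<bullet> j + d) *\<^sub>R j)"
        define l where "l = (\<Sum>j\<in>Basis. (if j = e then - R else x \<bullet> j - d) *\<^sub>R j)"
        have ul: "(u - l) \<bullet> j = (if j = e then 2 * R else 2 * d)" if "j \<in> Basis" for j
          using that by (simp add: u_def l_def inner_diff_left)
        have "T i = cbox l u"
          using 2 unfolding T_def x_def d_def u_def l_def by simp
        moreover have "l \<bullet> j \<le> u \<bullet> j" if "j \<in> Basis" for j
          using ul[OF that] R(1) d by (simp add: inner_diff_left split: if_splits)
        ultimately have "emeasure lborel (T i) = ennreal (\<Prod>j\<in>Basis. (u - l) \<bullet> j)"
          by simp
        also have "(\<Prod>j\<in>Basis. (u - l) \<bullet> j) = (\<Prod>j\<in>Basis. if j = e then 2 * R else 2 * d)"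
          using ul by (rule prod.cong[OF refl])
        also have "(\<Prod>j\<in>Basis. if j = e then 2 * R else 2 * d) = 2 * R * (2 * d) ^ s"
          using e by (subst prod.remove[of _ e]) (auto simp: s_def card_Diff_singleton)
        also have "\<dots> = 2 * R * (4 * (d / 2)) ^ s" by simp
        also have "\<dots> = c * (unit_ball_vol s * (d / 2) ^ s)"
          unfolding power_mult_distrib using unit_ball_vol_pos[of "real s"]
          by (simp add: c_def del: unit_ball_vol_pos)
        also have "ennreal \<dots> = ennreal c * hausdorff_gauge s 1 (C i)"
          using 2 c by (simp add: hausdorff_gauge_def d_def ennreal_mult')
        finally show ?thesis by simp
      next
        case 3
        then have "hausdorff_gauge s 1 (C i) = \<infinity>" unfolding hausdorff_gauge_def by auto
        then show ?thesis using c by (simp add: ennreal_mult_top)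
      qed (simp add: T_def)
    qed
    have "emeasure lborel K \<le> emeasure lborel (\<Union>i. T i)"
      using \<open>K \<subseteq> _\<close> Tm by (intro emeasure_mono) auto
    also have "\<dots> \<le> (\<Sum>i. emeasure lborel (T i))"
      using Tm by (intro emeasure_subadditive_countably) auto
    also have "\<dots> \<le> (\<Sum>i. ennreal c * hausdorff_gauge s 1 (C i))"
      using Tg by (intro suminf_le) auto
    finally show ?thesis by simp
  qed
  have "0 < emeasure lborel K / ennreal c"
    using K(2) by (simp add: ennreal_zero_less_divide)
  also have "\<dots> \<le> outer_measure UNIV (hausdorff_gauge s 1) (frontier K)"
    unfolding outer_measure_hausdorff_gauge_eq_INF
    using main c by (intro INF_greatest divide_le_posI_ennreal) (auto simp: mult.commute)
  also have "\<dots> \<le> hausdorff_outer s (frontier K)"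
    unfolding hausdorff_outer_def by (intro SUP_upper) auto
  finally show ?thesis by (simp add: s_def)
qed

section \<open>Averages of affine functions\<close>

text \<open>
  Substituting \<open>f x\<close> for \<open>x\<close> leaves the integral unchanged, and a linear map commutes with
  integration.
\<close>

lemma integral_fixed_by_symmetry:
  fixes f :: "'a::euclidean_space \<Rightarrow> 'a"
  assumes M: "sets M = sets borel" "distr M borel f = M"
    and f: "linear f" "inj f" "f ` A = A"
    and int: "set_integrable M A (\<lambda>x. x)"
  shows "f (LINT x:A|M. x) = (LINT x:A|M. x)"
proof -
  interpret bf: bounded_linear f using f(1) by (simp add: linear_conv_bounded_linear)
  have ind: "indicator A (f x) = (indicator A x :: real)" for x
    using inj_image_mem_iff[OF f(2), of x A] f(3) by (simp add: indicator_def)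
  have meas: "f \<in> measurable M borel"
    using borel_measurable_continuous_onI[OF linear_continuous_on[OF bf.bounded_linear_axioms]]
    by (simp add: M(1) cong: measurable_cong_sets)
  have "(LINT x:A|M. x) = (LINT x|distr M borel f. indicat_real A x *\<^sub>R x)"
    by (simp add: M(2) set_lebesgue_integral_def)
  also have "\<dots> = (LINT x|M. indicat_real A (f x) *\<^sub>R f x)"
    using int meas by (intro integral_distr)
      (auto simp: set_integrable_def M(1) cong: measurable_cong_sets dest: borel_measurable_integrable)
  also have "\<dots> = (LINT x|M. f (indicat_real A x *\<^sub>R x))"
    by (simp add: ind bf.scaleR)
  also have "\<dots> = f (LINT x:A|M. x)"
    unfolding set_lebesgue_integral_def
    using int by (intro integral_bounded_linear bf.bounded_linear_axioms) (simp add: set_integrable_def)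
  finally show ?thesis by simp
qed

text \<open>
  Used with \<open>M\<close> the volume and \<open>A = K\<close>, and with \<open>M\<close> the surface measure and \<open>A = frontier K\<close>: the
  moment \<open>m\<close> of \<open>A\<close> is fixed by all isometries of \<open>K\<close>, so it is the origin, and the linear part of
  \<open>U\<close> integrates to 0.
\<close>

lemma average_affine_eq_value_at_origin:
  fixes A :: "'a::euclidean_space set"
  assumes sets: "sets M = sets borel" and A: "A \<in> sets borel" "bounded A"
    and pos: "0 < emeasure M A" and fin: "emeasure M A < \<infinity>"
    and sym: "\<And>f. f \<in> isometries_of K \<Longrightarrow> distr M borel f = M \<and> f ` A = A"
    and lin: "\<And>f. f \<in> isometries_of K \<Longrightarrow> orthogonal_transformation f"
    and orb: "{x. is_singleton (isometry_orbit K x)} = {0}"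
    and U: "U \<in> polynomials_degree_le_1"
  shows "average M A U = U 0"
proof -
  have AM: "A \<in> sets M" using A sets by simp
  have ic: "set_integrable M A (\<lambda>x. c)" for c :: real
    unfolding set_integrable_def using AM fin by (auto intro!: integrable_real_indicator)
  obtain R where R: "\<And>x. x \<in> A \<Longrightarrow> norm x \<le> R" using A(2) bounded_iff by blast
  have id: "(\<lambda>x. x) \<in> borel_measurable M" using measurable_ident_sets[OF sets] by simp
  have int: "set_integrable M A (\<lambda>x. x)"
    unfolding set_integrable_def
  proof (rule integrableI_bounded_set[where A = A and B = R])
    show "(\<lambda>x. indicat_real A x *\<^sub>R x) \<in> borel_measurable M" using AM id by measurable
    show "AE x in M. x \<in> A \<longrightarrow> norm (indicat_real A x *\<^sub>R x) \<le> R" using R by auto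
  qed (use AM fin in auto)
  define m where "m = (LINT x:A|M. x)"
  have "f m = m" if "f \<in> isometries_of K" for f
    unfolding m_def using sym[OF that] lin[OF that] int sets
    by (intro integral_fixed_by_symmetry)
      (auto simp: orthogonal_transformation_linear orthogonal_transformation_inj)
  moreover have "id \<in> isometries_of K" by (simp add: isometries_of_def)
  ultimately have "isometry_orbit K m = {m}"
    unfolding isometry_orbit_def by (auto intro!: exI[of _ id])
  then have m: "m = 0" using orb by (auto simp: is_singleton_def)
  from U obtain c a where U': "U = (\<lambda>x. c + (\<Sum>i\<in>Basis. a i * (x \<bullet> i)))"
    by (auto simp: polynomials_degree_le_1_def)
  define v where "v = (\<Sum>i\<in>Basis. a i *\<^sub>R i)"
  have Uv: "U x = c + x \<bullet> v" for x by (simp add: U' v_def inner_sum_right)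
  have "integrable M (\<lambda>x. (indicat_real A x *\<^sub>R x) \<bullet> v)"
    using int unfolding set_integrable_def by (rule integrable_inner_left)
  then have iv: "set_integrable M A (\<lambda>x. x \<bullet> v)" by (simp add: set_integrable_def)
  have "(LINT x:A|M. U x) = (LINT x:A|M. c) + (LINT x:A|M. x \<bullet> v)"
    unfolding Uv
    by (intro set_integral_add ic) (rule iv)
  also have "(LINT x:A|M. x \<bullet> v) = m \<bullet> v"
    using int unfolding m_def set_lebesgue_integral_def set_integrable_def
    by (subst integral_inner_left[symmetric]) auto
  also have "(LINT x:A|M. c) = c * measure M A"
    using AM fin by (simp add: set_lebesgue_integral_def)
  finally have "(LINT x:A|M. U x) = c * measure M A" by (simp add: m)
  moreover have "measure M A > 0"
    using pos fin by (simp add: measure_def enn2real_positive_iff)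
  ultimately show ?thesis by (simp add: average_def Uv)
qed

theorem theorem6p5:
  fixes K :: "'a::euclidean_space set"
    and V :: "('a \<Rightarrow> real) set"
    and Q :: "'a set"
    and b :: "'a \<Rightarrow> real"
  assumes "centered_star_regular_polytope K"
    and "V = polynomials_degree_le_1"
    and "{x. is_singleton (isometry_orbit K x)} = {0}"
    and "boundary_quadrature K V Q b"
  shows "optimal_interior_weight K V = 1 \<and>
    (\<forall>U\<in>V. \<forall>(h :: 'a \<Rightarrow> real) (lam :: real) (dt :: real).
       (\<forall>x\<in>Q. 0 \<le> U x) \<longrightarrow>
       (\<forall>x\<in>Q. h x \<le> lam * U x) \<longrightarrow>
       0 \<le> dt \<longrightarrow>
       ereal (lam * dt) \<le> 1 / optimal_interior_weight K V \<longrightarrow>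
       0 \<le> cell_average K U - dt * quadrature Q b h)"
proof -
  obtain F where F: "finite F" "\<And>P. P \<in> F \<Longrightarrow> polytope P \<and> interior P \<noteq> {}" "K = \<Union>F"
    and "starlike K"
    using assms(1) unfolding centered_star_regular_polytope_def star_convex_polytope_def by blast
  have "K \<noteq> {}" using \<open>starlike K\<close> by (auto simp: starlike_def)
  have "compact K" unfolding F(3) using F(1,2) by (intro compact_Union polytope_imp_compact) auto
  obtain P where P: "P \<in> F" using F(3) \<open>K \<noteq> {}\<close> by auto
  then have "interior P \<subseteq> K" using F(3) interior_subset by blast
  then have int: "interior K \<noteq> {}" using F(2)[OF P] interior_maximal[of "interior P" K] by auto

  have fix0: "f 0 = 0" if "f \<in> isometries_of K" for f
  proof -
    have "is_singleton (isometry_orbit K 0)" using assms(3) by auto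
    moreover have "id \<in> isometries_of K" by (simp add: isometries_of_def)
    then have "id 0 \<in> isometry_orbit K 0" unfolding isometry_orbit_def by blast
    moreover have "f 0 \<in> isometry_orbit K 0" using that by (auto simp: isometry_orbit_def)
    ultimately show ?thesis by (auto simp: is_singleton_def)
  qed
  have orth: "orthogonal_transformation f" if "f \<in> isometries_of K" for f
    using that fix0[OF that] by (auto simp: orthogonal_transformation_isometry isometries_of_def)
  have img: "f ` K = K" if "f \<in> isometries_of K" for f
    using that by (auto simp: isometries_of_def)
  have imgF: "f ` frontier K = frontier K" if "f \<in> isometries_of K" for f
  proof -
    have f: "linear f" "inj f"
      using orth[OF that] by (auto intro: orthogonal_transformation_linear orthogonal_transformation_inj)
    have "f ` frontier K = f ` closure K - f ` interior K"
      unfolding frontier_def using f(2) by (rule image_set_diff)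
    also have "\<dots> = closure (f ` K) - interior (f ` K)"
      using f by (simp add: closure_injective_linear_image interior_injective_linear_image)
    finally show ?thesis by (simp add: img[OF that] frontier_def)
  qed

  obtain z r where "0 < r" "ball z r \<subseteq> K" using int mem_interior by blast
  have "0 < emeasure lborel (ball z r)" using \<open>0 < r\<close> by (simp add: emeasure_ball)
  also have "\<dots> \<le> emeasure lborel K"
    using \<open>compact K\<close> \<open>ball z r \<subseteq> K\<close> by (intro emeasure_mono) (auto intro: borel_compact)
  finally have volpos: "0 < emeasure lborel K" .

  have C: "cell_average K U = U 0" if "U \<in> V" for U
    unfolding cell_average_def
  proof (rule average_affine_eq_value_at_origin[OF _ _ _ volpos _ _ orth assms(3)])
    show "emeasure lborel K < \<infinity>" using \<open>compact K\<close>
      using emeasure_bounded_finite[of K] by (simp add: compact_imp_bounded)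
    show "distr lborel borel f = lborel \<and> f ` K = K" if "f \<in> isometries_of K" for f
      using distr_lborel_orthogonal_transformation[OF orth[OF that]] img[OF that] by simp
  qed (use \<open>compact K\<close> that assms(2) in \<open>auto intro: borel_compact compact_imp_bounded\<close>)

  have B: "boundary_average K U = U 0" if "U \<in> V" for U
    unfolding boundary_average_def
  proof (rule average_affine_eq_value_at_origin[OF _ _ _ _ _ _ orth assms(3)])
    show "0 < emeasure (hausdorff_measure (DIM('a) - 1)) (frontier K)"
      using hausdorff_outer_frontier_pos[OF compact_imp_bounded[OF \<open>compact K\<close>] volpos]
      by (simp add: emeasure_hausdorff_measure borel_closed)
    show "emeasure (hausdorff_measure (DIM('a) - 1)) (frontier K) < \<infinity>"
      using hausdorff_outer_frontier_Union_finite[OF F(1)] F(2,3)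
      by (simp add: emeasure_hausdorff_measure borel_closed polytope_imp_convex polytope_imp_compact)
    show "distr (hausdorff_measure (DIM('a) - 1)) borel f = hausdorff_measure (DIM('a) - 1)
        \<and> f ` frontier K = frontier K" if "f \<in> isometries_of K" for f
      using distr_hausdorff_measure_isometry[of f] orth[OF that] imgF[OF that]
      by (simp add: orthogonal_transformation_isometry orthogonal_transformation_surj)
    show "bounded (frontier K)"
      using \<open>compact K\<close> by (simp add: compact_frontier compact_imp_bounded)
  qed (use that assms(2) in \<open>auto intro: borel_closed\<close>)

  have one: "(\<lambda>x. 1) \<in> V"
    unfolding assms(2) polynomials_degree_le_1_def by (auto intro!: exI[of _ 1] exI[of _ "\<lambda>_. 0"])
  have "optimal_interior_weight K V
      = (SUP U\<in>{U \<in> V. (\<forall>x\<in>K. 0 \<le> U x) \<and> 0 < cell_average K U}. 1)"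
    unfolding optimal_interior_weight_def by (intro SUP_cong) (auto simp: B C one_ereal_def)
  also have "\<dots> = 1" using one C[OF one] by (subst SUP_const) auto
  finally have weight: "optimal_interior_weight K V = 1" .

  have "0 \<le> cell_average K U - dt * quadrature Q b h"
    if "U \<in> V" "\<forall>x\<in>Q. 0 \<le> U x" and h: "\<forall>x\<in>Q. h x \<le> lam * U x"
      and dt: "0 \<le> dt" "lam * dt \<le> 1" for U h lam dt
  proof -
    have b: "\<And>x. x \<in> Q \<Longrightarrow> 0 < b x" and "quadrature Q b U = boundary_average K U"
      using assms(4) \<open>U \<in> V\<close> by (auto simp: boundary_quadrature_def)
    then have q: "quadrature Q b U = cell_average K U" by (simp add: B C \<open>U \<in> V\<close>)
    have q0: "0 \<le> quadrature Q b U"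
      unfolding quadrature_def using b that(2) by (intro sum_nonneg) (simp add: less_imp_le)
    have "quadrature Q b h \<le> (\<Sum>x\<in>Q. b x * (lam * U x))"
      unfolding quadrature_def using b h by (intro sum_mono mult_left_mono) (auto intro: less_imp_le)
    also have "\<dots> = lam * quadrature Q b U"
      by (simp add: quadrature_def sum_distrib_left ac_simps)
    finally have "dt * quadrature Q b h \<le> (lam * dt) * quadrature Q b U"
      using dt(1) by (metis mult.assoc mult.commute mult_left_mono)
    also have "\<dots> \<le> 1 * quadrature Q b U" using dt(2) q0 by (rule mult_right_mono)
    finally show ?thesis by (simp add: q)
  qed
  with weight show ?thesis by (auto simp: one_ereal_def)
qed

end
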